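(* Let $\lambda>0$ and $f=h+\overline{g}\in\Omega_{\mathcal{H}}^0(\lambda)$. Then for all $z\in\mathbb{D}$, $$|z|-\lambda|z|^2\le|f(z)|\le|z|+\lambda|z|^2,$$ $$1-2\lambda|z|\le|f'(z)|\le1+2\lambda|z|,$$ where $f'(z):=h'(z)+\overline{g'(z)}$. Equality occurs in these inequalities for functions of the form $f_3(z)=z+\lambda\eta z^2\in\Omega_{\mathcal{H}}^0(\lambda)$ with $|\eta|=1$: for each of the four inequalities there exist $\eta$ with $|\eta|=1$ and $z\in\mathbb{D}$, $z\ne0$, at which $f_3$ gives equality.
   Context: $\mathbb{D}=\{z\in\mathbb{C}:|z|<1\}$. $\mathcal{H}^0$ is the class of complex-valued harmonic functions $f=h+\overline{g}$ on $\mathbb{D}$, where $h,g$ are analytic on $\mathbb{D}$ with $h(z)=z+\sum_{n\ge2}a_nz^n$ and $g(z)=\sum_{n\ge2}b_nz^n$. For $\lambda>0$, $\Omega_{\mathcal{H}}^0(\lambda)$ is the set of $f=h+\overline{g}\in\mathcal{H}^0$ such that $|h(z)-zh'(z)|<\lambda-|g(z)-zg'(z)|$ for all $z\in\mathbb{D}$. *)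

theory Defs
  imports "HOL-Complex_Analysis.Complex_Analysis"
begin

text \<open>
  Functions on the open unit disc are total functions of type complex to complex whose values
  outside the disc are irrelevant. Harmonicity of \<open>f\<close> on the disc is a consequence of the
  decomposition \<open>f = h + cnj g\<close> into holomorphic parts.
\<close>

definition H0_decomp ::
  "(complex \<Rightarrow> complex) \<Rightarrow> (complex \<Rightarrow> complex) \<Rightarrow> (complex \<Rightarrow> complex) \<Rightarrow> bool" where
  "H0_decomp f h g \<longleftrightarrow>
     h holomorphic_on ball 0 1 \<and> g holomorphic_on ball 0 1 \<and>
     (\<exists>a. \<forall>z\<in>ball 0 1. (\<lambda>n. a (n + 2) * z ^ (n + 2)) sums (h z - z)) \<and>
     (\<exists>b. \<forall>z\<in>ball 0 1. (\<lambda>n. b (n + 2) * z ^ (n + 2)) sums g z) \<and>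
     (\<forall>z\<in>ball 0 1. f z = h z + cnj (g z))"

definition H0 :: "(complex \<Rightarrow> complex) set" where
  "H0 = {f. \<exists>h g. H0_decomp f h g}"

definition Omega_H0 :: "real \<Rightarrow> (complex \<Rightarrow> complex) set" where
  "Omega_H0 l = {f \<in> H0. \<exists>h g. H0_decomp f h g \<and>
     (\<forall>z\<in>ball 0 1. cmod (h z - z * deriv h z) < l - cmod (g z - z * deriv g z))}"

text \<open>
  The expression \<open>h' + cnj g'\<close>, denoted \<open>f'\<close> for \<open>f = h + cnj g\<close>; it is not a complex
  derivative of \<open>f\<close>.
\<close>

definition harm_deriv ::
  "(complex \<Rightarrow> complex) \<Rightarrow> (complex \<Rightarrow> complex) \<Rightarrow> complex \<Rightarrow> complex" where
  "harm_deriv h g z = deriv h z + cnj (deriv g z)"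

definition f3 :: "real \<Rightarrow> complex \<Rightarrow> complex \<Rightarrow> complex" where
  "f3 l \<eta> z = z + complex_of_real l * \<eta> * z ^ 2"

end

theory Submission imports Defs begin

text \<open>
  For a unimodular \<open>\<epsilon>\<close>, the function \<open>u = h - z + \<epsilon> g\<close> has a double zero at the origin, say
  \<open>u = z\<^sup>2 \<psi>\<close>, and \<open>z u' - u = z\<^sup>2 (z \<psi>)'\<close> is bounded by \<open>\<lambda>\<close>. By the maximum principle
  \<open>(z \<psi>)'\<close> is bounded by \<open>\<lambda>\<close>, hence so is \<open>\<psi>\<close>, and \<open>u' = z (\<psi> + (z \<psi>)')\<close>. Choosing
  \<open>\<epsilon>\<close> at each point such that \<open>h - z\<close> and \<open>\<epsilon> g\<close> (or their derivatives) are aligned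
  bounds \<open>|h - z| + |g|\<close> (or \<open>|h' - 1| + |g'|\<close>).
\<close>

section \<open>Rotations and the maximum principle\<close>

lemma exists_aligning_rotation:
  fixes a b :: complex
  shows "\<exists>\<epsilon>. cmod \<epsilon> = 1 \<and> cmod (a + \<epsilon> * b) = cmod a + cmod b"
proof (cases "a = 0 \<or> b = 0")
  case True
  then show ?thesis by (intro exI[of _ 1]) auto
next
  case False
  \<comment> \<open>The quotient of the two unit vectors turns \<open>b\<close> onto the ray through
    \<open>a\<close>. The case split above is needed because \<open>sgn 0 = 0\<close> would not give
    a unimodular number.\<close>
  define \<epsilon> where "\<epsilon> = sgn a / sgn b"
  have "a + \<epsilon> * b = sgn a * of_real (cmod a + cmod b)"
    using False by (simp add: \<epsilon>_def sgn_eq field_simps)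
  moreover have "cmod \<epsilon> = 1"
    using False by (simp add: \<epsilon>_def norm_divide norm_sgn)
  ultimately show ?thesis
    using False by (intro exI[of _ \<epsilon>])
      (simp only: norm_mult norm_of_real, simp add: norm_sgn)
qed

text \<open>On the circle of radius \<open>r\<close> the hypothesis loses only the factor
  \<open>r ^ n\<close>; the maximum principle carries the bound \<open>B / r ^ n\<close> inside, and
  the factor disappears as \<open>r\<close> tends to 1.\<close>

lemma norm_le_of_norm_power_mult_le:
  fixes q :: "complex \<Rightarrow> complex"
  assumes hol: "q holomorphic_on ball 0 1"
    and bound: "\<And>w. w \<in> ball 0 1 \<Longrightarrow> cmod (w ^ n * q w) \<le> B"
    and z: "z \<in> ball 0 1"
  shows "cmod (q z) \<le> B"
proof -
  have le: "cmod (q z) \<le> B / r ^ n" if r: "r \<in> {cmod z<..<1}" for r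
  proof -
    have "0 < r" using r by (auto intro: order_le_less_trans[OF norm_ge_zero])
    have sub: "cball (0::complex) r \<subseteq> ball 0 1" using r by (simp add: cball_subset_ball_iff)
    show ?thesis
    proof (rule maximum_modulus_frontier[of q "cball 0 r"])
      show "q holomorphic_on interior (cball 0 r)"
        using hol sub by (meson holomorphic_on_subset interior_subset order_trans)
      show "continuous_on (closure (cball 0 r)) q"
        using hol sub by (simp add: holomorphic_on_imp_continuous_on holomorphic_on_subset)
      fix w assume "w \<in> frontier (cball (0::complex) r)"
      then have w: "cmod w = r" by (simp add: frontier_cball)
      then have "r ^ n * cmod (q w) \<le> B"
        using bound[of w] r by (simp add: norm_mult norm_power)
      then show "cmod (q w) \<le> B / r ^ n"
        using \<open>0 < r\<close> by (simp add: field_simps)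
    qed (use r in auto)
  qed
  have "((\<lambda>r. B / r ^ n) \<longlongrightarrow> B / 1 ^ n) (at_left (1::real))"
    by (intro tendsto_intros) auto
  moreover have "\<forall>\<^sub>F r in at_left 1. cmod (q z) \<le> B / r ^ n"
    unfolding eventually_at_left_field using le z by (intro exI[of _ "cmod z"]) auto
  ultimately show ?thesis
    by (auto intro: tendsto_lowerbound)
qed

section \<open>Functions with a double zero at the origin\<close>

text \<open>Dividing the series termwise by \<open>z^2\<close> leaves a power series that also
  converges at 0, so it defines the quotient on the whole disc without treating a removable
  singularity.\<close>

lemma power_series_double_zero:
  fixes u :: "complex \<Rightarrow> complex"
  assumes "\<And>z. z \<in> ball 0 1 \<Longrightarrow> (\<lambda>n. a (n + 2) * z ^ (n + 2)) sums u z"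
  shows "\<exists>\<psi>. \<psi> holomorphic_on ball 0 1 \<and> (\<forall>z\<in>ball 0 1. u z = z\<^sup>2 * \<psi> z)"
proof -
  define \<psi> where "\<psi> z = (\<Sum>n. a (n + 2) * z ^ n)" for z
  have sums: "(\<lambda>n. a (n + 2) * z ^ n) sums \<psi> z" if "z \<in> ball 0 1" for z
  proof (cases "z = 0")
    case True
    then show ?thesis
      unfolding \<psi>_def by (intro summable_sums) simp
  next
    case False
    have "(\<lambda>n. a (n + 2) * z ^ (n + 2) / z\<^sup>2) sums (u z / z\<^sup>2)"
      by (intro sums_divide assms that)
    also have "(\<lambda>n. a (n + 2) * z ^ (n + 2) / z\<^sup>2) = (\<lambda>n. a (n + 2) * z ^ n)"
      using False by (simp add: power_add power2_eq_square)
    finally show ?thesis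
      unfolding \<psi>_def by (simp add: sums_iff)
  qed
  have "u z = z\<^sup>2 * \<psi> z" if "z \<in> ball 0 1" for z
  proof -
    have "(\<lambda>n. a (n + 2) * z ^ (n + 2)) sums (z\<^sup>2 * \<psi> z)"
      using sums_mult[OF sums[OF that], of "z\<^sup>2"]
      by (simp add: power2_eq_square mult_ac)
    then show ?thesis
      using assms[OF that] sums_unique2 by blast
  qed
  moreover have "\<psi> holomorphic_on ball 0 1"
    by (rule power_series_holomorphic[where a = "\<lambda>n. a (n + 2)"]) (use sums in auto)
  ultimately show ?thesis by blast
qed

lemma double_zero_bounds:
  fixes u \<psi> :: "complex \<Rightarrow> complex"
  assumes hol: "\<psi> holomorphic_on ball 0 1"
    and u: "\<And>w. w \<in> ball 0 1 \<Longrightarrow> u w = w\<^sup>2 * \<psi> w"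
    and bound: "\<And>w. w \<in> ball 0 1 \<Longrightarrow> cmod (w * deriv u w - u w) \<le> l"
    and z: "z \<in> ball 0 1"
  shows "cmod (u z) \<le> l * (cmod z)\<^sup>2" and "cmod (deriv u z) \<le> 2 * l * cmod z"
proof -
  \<comment> \<open>This is the derivative of \<open>w * \<psi> w\<close>.\<close>
  define q where "q w = \<psi> w + w * deriv \<psi> w" for w
  have d\<psi>: "(\<psi> has_field_derivative deriv \<psi> w) (at w)" if "w \<in> ball 0 1" for w
    using hol that by (auto intro: holomorphic_derivI)
  have du: "deriv u w = w * (\<psi> w + q w)" if w: "w \<in> ball 0 1" for w
  proof -
    have "((\<lambda>w. w\<^sup>2 * \<psi> w) has_field_derivative w * (\<psi> w + q w)) (at w)"
      by (rule derivative_eq_intros d\<psi>[OF w] refl)+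
        (simp add: q_def power2_eq_square algebra_simps)
    then have "(u has_field_derivative w * (\<psi> w + q w)) (at w)"
      by (rule has_field_derivative_transform_within_open[of _ _ _ "ball 0 1"])
        (use w u in auto)
    then show ?thesis by (rule DERIV_imp_deriv)
  qed
  have "q holomorphic_on ball 0 1"
    unfolding q_def by (intro holomorphic_intros hol) auto
  moreover have "cmod (w\<^sup>2 * q w) \<le> l" if "w \<in> ball 0 1" for w
  proof -
    have "w * deriv u w - u w = w\<^sup>2 * q w"
      using du[OF that] u[OF that] by (simp add: power2_eq_square algebra_simps)
    then show ?thesis using bound[OF that] by simp
  qed
  ultimately have q: "cmod (q w) \<le> l" if "w \<in> ball 0 1" for w
    using norm_le_of_norm_power_mult_le that by blast
  \<comment> \<open>Mean value inequality on the convex disc, from 0 to \<open>z\<close>. Keeping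
    the factor \<open>z\<close> in front of \<open>\<psi> z\<close> avoids a separate case
    \<open>z = 0\<close>.\<close>
  have "cmod (z * \<psi> z - 0 * \<psi> 0) \<le> l * cmod (z - 0)"
  proof (rule field_differentiable_bound[of "ball 0 1" "\<lambda>w. w * \<psi> w" q])
    show "((\<lambda>w. w * \<psi> w) has_field_derivative q w) (at w within ball 0 1)"
      if "w \<in> ball 0 1" for w
      by (rule has_field_derivative_at_within)
        (rule derivative_eq_intros d\<psi>[OF that] refl | simp add: q_def)+
  qed (use q z in auto)
  then have z\<psi>: "cmod (z * \<psi> z) \<le> l * cmod z" by simp
  have "cmod (u z) = cmod z * cmod (z * \<psi> z)"
    using u[OF z] by (simp add: norm_mult power2_eq_square)
  also have "\<dots> \<le> cmod z * (l * cmod z)"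
    using z\<psi> by (intro mult_left_mono) auto
  finally show "cmod (u z) \<le> l * (cmod z)\<^sup>2"
    by (simp add: power2_eq_square mult_ac)
  \<comment> \<open>The constant 2 arises here: \<open>z * \<psi> z\<close> and
    \<open>z * q z\<close> each contribute \<open>l * cmod z\<close>.\<close>
  have "cmod (deriv u z) \<le> cmod (z * \<psi> z) + cmod z * cmod (q z)"
    using norm_triangle_ineq[of "z * \<psi> z" "z * q z"] du[OF z]
    by (simp add: norm_mult distrib_left)
  also have "\<dots> \<le> l * cmod z + cmod z * l"
    using z\<psi> q[OF z] by (intro add_mono mult_left_mono) auto
  finally show "cmod (deriv u z) \<le> 2 * l * cmod z" by simp
qed

section \<open>Uniqueness of the decomposition up to derivatives\<close>

text \<open>The real derivative of \<open>cnj (F w)\<close> is conjugate-linear by the chain rule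
  and complex-linear by assumption. Comparing both forms at 1 and at \<open>\<i>\<close> gives
  \<open>E = cnj D\<close> and \<open>E = - cnj D\<close>.\<close>

lemma deriv_eq_0_if_cnj_differentiable:
  assumes F: "(F has_field_derivative D) (at z)"
    and G: "((\<lambda>w. cnj (F w)) has_field_derivative E) (at z)"
  shows "D = 0" and "E = 0"
proof -
  have "((\<lambda>w. cnj (F w)) has_derivative (\<lambda>t. cnj (D * t))) (at z)"
    using F by (intro has_derivative_cnj) (simp add: has_field_derivative_def)
  with G have eq: "(*) E = (\<lambda>t. cnj (D * t))"
    unfolding has_field_derivative_def by (rule has_derivative_unique)
  have "E = cnj D" using fun_cong[OF eq, of 1] by simp
  moreover have "E = - cnj D" using fun_cong[OF eq, of \<i>] by (simp add: complex_eq_iff)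
  ultimately show "D = 0" "E = 0" by auto
qed

text \<open>Makes \<open>harm_deriv\<close> independent of the chosen decomposition:
  \<open>cnj (h w - k w)\<close> equals the holomorphic function \<open>m w - g w\<close>, so both
  differences have derivative 0.\<close>

lemma H0_decomp_deriv_unique:
  assumes "H0_decomp f h g" "H0_decomp f k m" and z: "z \<in> ball 0 1"
  shows "deriv h z = deriv k z" and "deriv g z = deriv m z"
proof -
  have d: "(h has_field_derivative deriv h z) (at z)" "(g has_field_derivative deriv g z) (at z)"
    "(k has_field_derivative deriv k z) (at z)" "(m has_field_derivative deriv m z) (at z)"
    using assms by (auto simp: H0_decomp_def intro: holomorphic_derivI)
  have "m w - g w = cnj (h w - k w)" if "w \<in> ball 0 1" for w
  proof -
    have "h w + cnj (g w) = k w + cnj (m w)"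
      using assms that unfolding H0_decomp_def by metis
    then have "cnj (h w + cnj (g w)) = cnj (k w + cnj (m w))" by simp
    then show ?thesis by (simp add: algebra_simps)
  qed
  then have "((\<lambda>w. cnj (h w - k w)) has_field_derivative deriv m z - deriv g z) (at z)"
    by (rule has_field_derivative_transform_within_open[OF DERIV_diff[OF d(4) d(2)] open_ball z])
  from deriv_eq_0_if_cnj_differentiable[OF DERIV_diff[OF d(1) d(3)] this]
  show "deriv h z = deriv k z" "deriv g z = deriv m z" by simp_all
qed

section \<open>Growth and distortion estimates\<close>

text \<open>Measuring the distance to the identity map and to its derivative 1 lets one estimate
  yield both the upper and the lower bound.\<close>

lemma H0_decomp_bounds:
  assumes dec: "H0_decomp f h g"
    and bound: "\<And>w. w \<in> ball 0 1 \<Longrightarrow>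
      cmod (h w - w * deriv h w) < l - cmod (g w - w * deriv g w)"
    and z: "z \<in> ball 0 1"
  shows "cmod (f z - z) \<le> l * (cmod z)\<^sup>2" and "cmod (harm_deriv h g z - 1) \<le> 2 * l * cmod z"
proof -
  from dec obtain a b where
    "\<And>z. z \<in> ball 0 1 \<Longrightarrow> (\<lambda>n. a (n + 2) * z ^ (n + 2)) sums (h z - z)"
    "\<And>z. z \<in> ball 0 1 \<Longrightarrow> (\<lambda>n. b (n + 2) * z ^ (n + 2)) sums g z"
    unfolding H0_decomp_def by blast
  note ex = this[THEN power_series_double_zero]
  obtain \<psi> where \<psi>: "\<psi> holomorphic_on ball 0 1" "\<And>w. w \<in> ball 0 1 \<Longrightarrow> h w - w = w\<^sup>2 * \<psi> w"
    using ex(1) by blast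
  obtain \<phi> where \<phi>: "\<phi> holomorphic_on ball 0 1" "\<And>w. w \<in> ball 0 1 \<Longrightarrow> g w = w\<^sup>2 * \<phi> w"
    using ex(2) by blast
  have hol: "h holomorphic_on ball 0 1" "g holomorphic_on ball 0 1"
    using dec by (auto simp: H0_decomp_def)
  define u where "u \<epsilon> w = h w - w + \<epsilon> * g w" for \<epsilon> w
  have du: "deriv (u \<epsilon>) w = deriv h w - 1 + \<epsilon> * deriv g w" if "w \<in> ball 0 1" for \<epsilon> w
    unfolding u_def using that hol
    by (intro DERIV_imp_deriv) (auto intro!: derivative_eq_intros holomorphic_derivI[of _ "ball 0 1"])
  have *: "cmod (u \<epsilon> z) \<le> l * (cmod z)\<^sup>2" "cmod (deriv (u \<epsilon>) z) \<le> 2 * l * cmod z"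
    if \<epsilon>: "cmod \<epsilon> = 1" for \<epsilon>
  proof -
    have hol\<epsilon>: "(\<lambda>w. \<psi> w + \<epsilon> * \<phi> w) holomorphic_on ball 0 1"
      by (intro holomorphic_intros \<psi> \<phi>)
    have eq: "u \<epsilon> w = w\<^sup>2 * (\<psi> w + \<epsilon> * \<phi> w)" if "w \<in> ball 0 1" for w
      using \<psi>(2)[OF that] \<phi>(2)[OF that] by (simp add: u_def algebra_simps)
    have le: "cmod (w * deriv (u \<epsilon>) w - u \<epsilon> w) \<le> l" if "w \<in> ball 0 1" for w
    proof -
      \<comment> \<open>The summand \<open>- w\<close> of \<open>u\<close> drops out, since the
        identity map satisfies \<open>w * 1 - w = 0\<close>.\<close>
      have "w * deriv (u \<epsilon>) w - u \<epsilon> w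
          = - ((h w - w * deriv h w) + \<epsilon> * (g w - w * deriv g w))"
        unfolding du[OF that] u_def by (simp add: algebra_simps)
      also have "cmod \<dots> \<le> cmod (h w - w * deriv h w) + cmod (\<epsilon> * (g w - w * deriv g w))"
        unfolding norm_minus_cancel by (rule norm_triangle_ineq)
      also have "\<dots> \<le> l"
        using bound[OF that] \<epsilon> by (simp add: norm_mult)
      finally show ?thesis .
    qed
    show "cmod (u \<epsilon> z) \<le> l * (cmod z)\<^sup>2" "cmod (deriv (u \<epsilon>) z) \<le> 2 * l * cmod z"
      using double_zero_bounds[OF hol\<epsilon> eq le z] by auto
  qed
  obtain \<epsilon> where \<epsilon>: "cmod \<epsilon> = 1" "cmod (u \<epsilon> z) = cmod (h z - z) + cmod (g z)"
    unfolding u_def using exists_aligning_rotation by blast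
  have "f z - z = (h z - z) + cnj (g z)"
    using dec z by (simp add: H0_decomp_def)
  then have "cmod (f z - z) \<le> cmod (u \<epsilon> z)"
    using norm_triangle_ineq[of "h z - z" "cnj (g z)"] unfolding \<epsilon>(2) by (metis complex_mod_cnj)
  with *(1)[OF \<epsilon>(1)] show "cmod (f z - z) \<le> l * (cmod z)\<^sup>2" by linarith
  \<comment> \<open>Aligning the derivatives may require a different rotation than aligning the
    values.\<close>
  obtain \<epsilon>' where \<epsilon>': "cmod \<epsilon>' = 1"
    "cmod (deriv (u \<epsilon>') z) = cmod (deriv h z - 1) + cmod (deriv g z)"
    unfolding du[OF z] using exists_aligning_rotation by blast
  have "harm_deriv h g z - 1 = (deriv h z - 1) + cnj (deriv g z)"
    by (simp add: harm_deriv_def)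
  then have "cmod (harm_deriv h g z - 1) \<le> cmod (deriv (u \<epsilon>') z)"
    using norm_triangle_ineq[of "deriv h z - 1" "cnj (deriv g z)"] unfolding \<epsilon>'(2)
    by (metis complex_mod_cnj)
  with *(2)[OF \<epsilon>'(1)] show "cmod (harm_deriv h g z - 1) \<le> 2 * l * cmod z" by linarith
qed

section \<open>The extremal functions\<close>

lemma deriv_f3: "deriv (f3 l \<eta>) z = 1 + 2 * of_real l * \<eta> * z"
  unfolding f3_def by (intro DERIV_imp_deriv) (auto intro!: derivative_eq_intros)

lemma H0_decomp_f3: "H0_decomp (f3 l \<eta>) (f3 l \<eta>) (\<lambda>_. 0)"
proof -
  \<comment> \<open>The coefficient of \<open>z^2\<close> is the term of index 0 in the shifted
    series, hence the support \<open>{0}\<close> below.\<close>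
  define a where "a n = (if n = 2 then of_real l * \<eta> else 0)" for n :: nat
  have "(\<lambda>n. a (n + 2) * z ^ (n + 2)) sums (f3 l \<eta> z - z)" for z
    using sums_finite[of "{0}" "\<lambda>n. a (n + 2) * z ^ (n + 2)"] by (simp add: a_def f3_def power2_eq_square)
  moreover have "f3 l \<eta> holomorphic_on ball 0 1"
    unfolding f3_def by (intro holomorphic_intros)
  moreover have "(\<lambda>n. 0 * z ^ (n + 2)) sums 0" for z :: complex by simp
  ultimately show ?thesis
    unfolding H0_decomp_def
    by (intro conjI) (blast | intro exI[of _ "\<lambda>_. 0"] | simp)+
qed

text \<open>Only the quadratic term survives in \<open>f3 - z f3'\<close>; its modulus is
  \<open>l * (cmod z)^2\<close>, which stays strictly below \<open>l\<close> in the open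
  disc.\<close>

lemma f3_in_Omega_H0:
  assumes "l > 0" "cmod \<eta> = 1"
  shows "f3 l \<eta> \<in> Omega_H0 l"
proof -
  have "cmod (f3 l \<eta> z - z * deriv (f3 l \<eta>) z) < l" if "z \<in> ball 0 1" for z
  proof -
    have "f3 l \<eta> z - z * deriv (f3 l \<eta>) z = - (of_real l * \<eta> * z\<^sup>2)"
      unfolding deriv_f3 f3_def by (simp add: power2_eq_square algebra_simps)
    then have "cmod (f3 l \<eta> z - z * deriv (f3 l \<eta>) z) = l * (cmod z)\<^sup>2"
      using assms by (simp add: norm_mult norm_power)
    also have "\<dots> < l * 1"
      using assms that by (intro mult_strict_left_mono) (auto simp: power_less_one_iff abs_square_less_1)
    finally show ?thesis by simp
  qed
  then show ?thesis
    unfolding Omega_H0_def H0_def using H0_decomp_f3[of l \<eta>]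
    by (intro CollectI conjI exI[of _ "f3 l \<eta>"] exI[of _ "\<lambda>_. 0"]) (blast, assumption, simp)
qed

theorem theorem2p4:
  fixes l :: real
  assumes "l > 0"
  shows
    "(\<forall>f h g. f \<in> Omega_H0 l \<longrightarrow> H0_decomp f h g \<longrightarrow>
        (\<forall>z\<in>ball 0 1.
           cmod z - l * (cmod z)^2 \<le> cmod (f z) \<and>
           cmod (f z) \<le> cmod z + l * (cmod z)^2 \<and>
           1 - 2 * l * cmod z \<le> cmod (harm_deriv h g z) \<and>
           cmod (harm_deriv h g z) \<le> 1 + 2 * l * cmod z)) \<and>
     (\<forall>\<eta>. cmod \<eta> = 1 \<longrightarrow> f3 l \<eta> \<in> Omega_H0 l) \<and>
     (\<exists>\<eta> z. cmod \<eta> = 1 \<and> z \<in> ball 0 1 \<and> z \<noteq> 0 \<and>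
        cmod (f3 l \<eta> z) = cmod z - l * (cmod z)^2) \<and>
     (\<exists>\<eta> z. cmod \<eta> = 1 \<and> z \<in> ball 0 1 \<and> z \<noteq> 0 \<and>
        cmod (f3 l \<eta> z) = cmod z + l * (cmod z)^2) \<and>
     (\<exists>\<eta> z h g. cmod \<eta> = 1 \<and> z \<in> ball 0 1 \<and> z \<noteq> 0 \<and> H0_decomp (f3 l \<eta>) h g \<and>
        cmod (harm_deriv h g z) = 1 - 2 * l * cmod z) \<and>
     (\<exists>\<eta> z h g. cmod \<eta> = 1 \<and> z \<in> ball 0 1 \<and> z \<noteq> 0 \<and> H0_decomp (f3 l \<eta>) h g \<and>
        cmod (harm_deriv h g z) = 1 + 2 * l * cmod z)"
proof -
  have bounds: "cmod z - l * (cmod z)\<^sup>2 \<le> cmod (f z) \<and> cmod (f z) \<le> cmod z + l * (cmod z)\<^sup>2 \<and>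
      1 - 2 * l * cmod z \<le> cmod (harm_deriv h g z) \<and> cmod (harm_deriv h g z) \<le> 1 + 2 * l * cmod z"
    if "f \<in> Omega_H0 l" and dec: "H0_decomp f h g" and z: "z \<in> ball 0 1" for f h g z
  proof -
    \<comment> \<open>Membership in the class provides some decomposition with the defining
      inequality, possibly not the given \<open>h\<close>, \<open>g\<close>.\<close>
    from that obtain k m where km: "H0_decomp f k m"
      "\<And>w. w \<in> ball 0 1 \<Longrightarrow> cmod (k w - w * deriv k w) < l - cmod (m w - w * deriv m w)"
      unfolding Omega_H0_def by blast
    have "harm_deriv h g z = harm_deriv k m z"
      using H0_decomp_deriv_unique[OF dec km(1) z] by (simp add: harm_deriv_def)
    then have "cmod (f z - z) \<le> l * (cmod z)\<^sup>2" "cmod (harm_deriv h g z - 1) \<le> 2 * l * cmod z"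
      using H0_decomp_bounds[OF km z] by auto
    \<comment> \<open>Each of the two reverse triangle inequalities gives a lower and an upper
      bound.\<close>
    then show ?thesis
      using norm_triangle_ineq3[of "f z" z] norm_triangle_ineq3[of "harm_deriv h g z" 1]
      by (simp add: abs_le_iff)
  qed
  \<comment> \<open>This radius satisfies both \<open>r < 1\<close> and
    \<open>2 * l * r < 1\<close>, so \<open>r - l * r^2\<close> and \<open>1 - 2 * l * r\<close> are
    nonnegative and equal their absolute values. The lower bounds are attained with \<eta> = -1, the
    upper ones with \<eta> = 1.\<close>
  define r where "r = 1 / (2 * (l + 1))"
  define x where "x = complex_of_real r"
  have r: "0 < r" "r < 1" "2 * l * r < 1"
    using assms by (auto simp: r_def field_simps)
  have x: "x \<in> ball 0 1" "x \<noteq> 0" "cmod x = r"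
    using r by (auto simp: x_def)
  have lr: "l * r\<^sup>2 \<le> r"
  proof -
    have "(l * r) * r \<le> 1 * r" using r by (intro mult_right_mono) auto
    then show ?thesis by (simp add: power2_eq_square mult_ac)
  qed
  have "f3 l (-1) x = of_real (r - l * r\<^sup>2)" "f3 l 1 x = of_real (r + l * r\<^sup>2)"
    by (simp_all add: f3_def x_def)
  then have f: "cmod (f3 l (-1) x) = cmod x - l * (cmod x)\<^sup>2"
    "cmod (f3 l 1 x) = cmod x + l * (cmod x)\<^sup>2"
    using lr r assms x by (simp_all only: norm_of_real) auto
  have "harm_deriv (f3 l (-1)) (\<lambda>_. 0) x = of_real (1 - 2 * l * r)"
    "harm_deriv (f3 l 1) (\<lambda>_. 0) x = of_real (1 + 2 * l * r)"
    by (simp_all add: harm_deriv_def deriv_f3 x_def)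
  then have d: "cmod (harm_deriv (f3 l (-1)) (\<lambda>_. 0) x) = 1 - 2 * l * cmod x"
    "cmod (harm_deriv (f3 l 1) (\<lambda>_. 0) x) = 1 + 2 * l * cmod x"
    using r assms x by (simp_all only: norm_of_real) auto
  have unit: "cmod (-1) = 1" "cmod 1 = 1" by simp_all
  show ?thesis
  proof (intro conjI)
    show "\<forall>f h g. f \<in> Omega_H0 l \<longrightarrow> H0_decomp f h g \<longrightarrow> (\<forall>z\<in>ball 0 1.
        cmod z - l * (cmod z)\<^sup>2 \<le> cmod (f z) \<and> cmod (f z) \<le> cmod z + l * (cmod z)\<^sup>2 \<and>
        1 - 2 * l * cmod z \<le> cmod (harm_deriv h g z) \<and>
        cmod (harm_deriv h g z) \<le> 1 + 2 * l * cmod z)"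
      using bounds by (intro allI impI ballI)
    show "\<forall>\<eta>. cmod \<eta> = 1 \<longrightarrow> f3 l \<eta> \<in> Omega_H0 l"
      using f3_in_Omega_H0[OF assms] by (intro allI impI)
    \<comment> \<open>The first fact to match fixes \<eta>: \<open>unit\<close> selects -1, while
      \<open>unit(2)\<close> selects 1.\<close>
    show "\<exists>\<eta> z. cmod \<eta> = 1 \<and> z \<in> ball 0 1 \<and> z \<noteq> 0 \<and> cmod (f3 l \<eta> z) = cmod z - l * (cmod z)\<^sup>2"
      by (intro exI conjI) (rule unit x f)+
    show "\<exists>\<eta> z. cmod \<eta> = 1 \<and> z \<in> ball 0 1 \<and> z \<noteq> 0 \<and> cmod (f3 l \<eta> z) = cmod z + l * (cmod z)\<^sup>2"
      by (intro exI conjI) (rule unit(2) x f)+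
    show "\<exists>\<eta> z h g. cmod \<eta> = 1 \<and> z \<in> ball 0 1 \<and> z \<noteq> 0 \<and> H0_decomp (f3 l \<eta>) h g \<and>
        cmod (harm_deriv h g z) = 1 - 2 * l * cmod z"
      by (intro exI conjI) (rule unit x H0_decomp_f3 d)+
    show "\<exists>\<eta> z h g. cmod \<eta> = 1 \<and> z \<in> ball 0 1 \<and> z \<noteq> 0 \<and> H0_decomp (f3 l \<eta>) h g \<and>
        cmod (harm_deriv h g z) = 1 + 2 * l * cmod z"
      by (intro exI conjI) (rule unit(2) x H0_decomp_f3 d)+
  qed
qed

end
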